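(* If $G$ is a Tarski monster group, then $G$ admits a strongly aperiodic subshift of finite type.
   Context: A Tarski monster group is an infinite finitely generated (simple) group for which there is a prime $p$ such that every nontrivial proper subgroup has finite order $p$. Let $A$ be a finite alphabet. $G$ acts on $A^G$ by $(gx)_h=x_{g^{-1}h}$. A subshift of finite type (SFT) over $G$ is a set $X\subseteq A^G$ for which there is a finite set $L$ of maps $w:D_w\to A$ ($D_w\subseteq G$ finite) such that $X$ is the set of all $x\in A^G$ such that for every $g\in G$ and $w\in L$ the restriction of $gx$ to $D_w$ differs from $w$. Let $Stab(x)=\{g\in G:gx=x\}$. A subshift $X$ is strongly aperiodic if it is nonempty and $Stab(x)$ is finite for every $x\in X$. "$G$ admits" such an SFT means one exists over some finite alphabet. *)

theory Defs
  imports "HOL-Algebra.Algebra"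
begin

(* No simplicity axiom: it follows, see normal_trivial below. The library locale simple_group
   cannot be used here, since it requires order G > 1 and order G = 0 for infinite G. *)
locale tarski_monster = group +
  assumes infinite_carrier: "infinite (carrier G)"
    and finitely_generated: "\<exists>S. finite S \<and> S \<subseteq> carrier G \<and> generate G S = carrier G"
    and proper_subgroups:
      "\<exists>p::nat. Factorial_Ring.prime p \<and> (\<forall>H. subgroup H G \<longrightarrow> H \<noteq> {\<one>} \<longrightarrow> H \<noteq> carrier G \<longrightarrow> card H = p)"

lemma (in tarski_monster) infinite_subgroup:
  assumes "subgroup H G" "infinite H"
  shows "H = carrier G"
proof (rule ccontr)
  assume "H \<noteq> carrier G"
  moreover have "H \<noteq> {\<one>}" using assms(2) by auto
  ultimately have "\<exists>p::nat. Factorial_Ring.prime p \<and> card H = p" using proper_subgroups assms(1) by blast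
  then show False using assms(2) by auto
qed

lemma (in tarski_monster) ord_nonzero:
  assumes g: "g \<in> carrier G"
  shows "ord g \<noteq> 0"
proof
  assume g0: "ord g = 0"
  have carr: "carrier (subgroup_generated G {x}) = generate G {x}" if "x \<in> carrier G" for x
    using that by (simp add: subgroup_generated_def)
  have inj: "\<And>i j::int. g [^] i = g [^] j \<Longrightarrow> i = j"
    using infinite_cyclic_subgroup_int[OF g] infinite_cyclic_subgroup_order[OF g] g0 by blast
  define h where "h = g [^] (2::int)"
  have h: "h \<in> carrier G" using g by (simp add: h_def)
  have pow: "h [^] i = g [^] (2 * i)" for i :: int
    using g by (simp add: h_def int_pow_pow)
  have "i = j" if "h [^] i = h [^] j" for i j :: int
  proof -
    have "2 * i = 2 * j" by (rule inj) (use that in \<open>simp only: pow\<close>)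
    then show ?thesis by simp
  qed
  then have "infinite (generate G {h})"
    using infinite_cyclic_subgroup_int[OF h] carr[OF h] by metis
  then have "generate G {h} = carrier G"
    using infinite_subgroup generate_is_subgroup h by simp
  then obtain k :: int where "g = h [^] k" using g generate_pow[OF h] by auto
  then have "g [^] (1::int) = g [^] (2 * k)" using g by (simp add: pow)
  then have "1 = 2 * k" by (rule inj)
  then show False by presburger
qed

lemma (in tarski_monster) normal_trivial:
  assumes N: "N \<lhd> G"
  shows "N = {\<one>} \<or> N = carrier G"
proof (rule ccontr)
  assume nt: "\<not> ?thesis"
  have sN: "subgroup N G" using N by (rule normal_imp_subgroup)
  obtain p :: nat where p: "Factorial_Ring.prime p"
    "\<And>H. \<lbrakk>subgroup H G; H \<noteq> {\<one>}; H \<noteq> carrier G\<rbrakk> \<Longrightarrow> card H = p"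
    using proper_subgroups by blast
  have cN: "card N = p" using p(2) sN nt by blast
  obtain g where g: "g \<in> carrier G" "g \<notin> N" using nt subgroup.subset[OF sN] by blast
  let ?C = "generate G {g}"
  have sC: "subgroup ?C G" using g generate_is_subgroup by simp
  have "card ?C \<noteq> 0" using generate_pow_card[OF g(1)] ord_nonzero[OF g(1)] by simp
  then have fC: "finite ?C" by (meson card.infinite)
  have fN: "finite N" using cN p(1) by (metis card.infinite not_prime_0)
  let ?K = "N <#> ?C"
  have sK: "subgroup ?K G" using mult_norm_subgroup[OF N sC] .
  have fK: "finite ?K" using fN fC by (simp add: set_mult_def)
  have NK: "N \<subseteq> ?K"
  proof
    fix x assume x: "x \<in> N"
    then have "x = x \<otimes> \<one>" using subgroup.mem_carrier[OF sN] by simp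
    then show "x \<in> ?K" unfolding set_mult_def using x generate.one by blast
  qed
  have gC: "g \<in> ?C" by (rule generate.incl) simp
  have "g = \<one> \<otimes> g" using g by simp
  then have gK: "g \<in> ?K" unfolding set_mult_def using gC subgroup.one_closed[OF sN] by blast
  have "?K \<noteq> {\<one>}" using gK g subgroup.one_closed[OF sN] by auto
  moreover have "?K \<noteq> carrier G" using fK infinite_carrier by auto
  ultimately have "card ?K = card N" using p(2) sK cN by simp
  then have "N = ?K" using card_subset_eq[OF fK NK] by simp
  then show False using g gK by blast
qed

text \<open>The full shift \<open>A\<^sup>G\<close> is \<open>carrier G \<rightarrow>\<^sub>E A\<close>.\<close>

definition shift :: "('g, 'm) monoid_scheme \<Rightarrow> 'g \<Rightarrow> ('g \<Rightarrow> 'a) \<Rightarrow> 'g \<Rightarrow> 'a" where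
  "shift G g x = (\<lambda>h \<in> carrier G. x (inv\<^bsub>G\<^esub> g \<otimes>\<^bsub>G\<^esub> h))"

text \<open>A map \<open>w : D \<rightarrow> A\<close> is represented as a pair \<open>(D, w)\<close> with \<open>w\<close> extensional on \<open>D\<close>.\<close>

definition subshift_of_finite_type ::
  "('g, 'm) monoid_scheme \<Rightarrow> 'a set \<Rightarrow> ('g \<Rightarrow> 'a) set \<Rightarrow> bool" where
  "subshift_of_finite_type G A S \<longleftrightarrow>
    (\<exists>L. finite L \<and>
      (\<forall>(D, w) \<in> L. finite D \<and> D \<subseteq> carrier G \<and> w \<in> D \<rightarrow>\<^sub>E A) \<and>
      S = {x \<in> carrier G \<rightarrow>\<^sub>E A.
             \<forall>g \<in> carrier G. \<forall>(D, w) \<in> L. restrict (shift G g x) D \<noteq> w})"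

definition strongly_aperiodic :: "('g, 'm) monoid_scheme \<Rightarrow> ('g \<Rightarrow> 'a) set \<Rightarrow> bool" where
  "strongly_aperiodic G S \<longleftrightarrow> S \<noteq> {} \<and> (\<forall>x \<in> S. finite (stabilizer G (shift G) x))"

text \<open>Every finite alphabet is in bijection with a finite set of natural numbers, so quantifying
  over the latter loses no generality.\<close>

definition admits_strongly_aperiodic_SFT :: "('g, 'm) monoid_scheme \<Rightarrow> bool" where
  "admits_strongly_aperiodic_SFT G \<longleftrightarrow>
    (\<exists>(A :: nat set) S. finite A \<and> subshift_of_finite_type G A S \<and> strongly_aperiodic G S)"

end

theory Submission
  imports Defs
begin

text \<open>
  An infinite stabilizer is an infinite subgroup, and in a Tarski monster the only such subgroup
  is the whole group (\<open>infinite_subgroup\<close>). A point fixed by the whole group is constant. So a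
  nonempty subshift of finite type is strongly aperiodic as soon as it contains no constant
  configuration, and what is needed is a local rule that excludes constants but can be satisfied.

  Torsion provides one. Every element of a Tarski monster has finite order (\<open>ord_nonzero\<close>), so
  there is a finite nontrivial subgroup \<open>D\<close>. The rule, over the alphabet \<open>{0, 1}\<close>, is that no left
  coset of \<open>D\<close> is monochromatic. Because left cosets partition the group, the rule can be met in
  each coset independently: the indicator function of a transversal works
  (\<open>ex_nonmonochromatic_configuration\<close>).
\<close>

context group
begin

lemma shift_one:
  assumes "x \<in> extensional (carrier G)"
  shows "shift G \<one> x = x"
  using assms by (intro ext) (simp add: shift_def extensional_def)

lemma shift_mult:
  assumes "g \<in> carrier G" "h \<in> carrier G"
  shows "shift G (g \<otimes> h) x = shift G g (shift G h x)"
  using assms by (intro ext) (simp add: shift_def inv_mult_group m_assoc)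

lemma subgroup_stabilizer_shift:
  assumes x: "x \<in> extensional (carrier G)"
  shows "subgroup (stabilizer G (shift G) x) G"
proof
  show "stabilizer G (shift G) x \<subseteq> carrier G" by (auto simp: stabilizer_def)
  show "\<one> \<in> stabilizer G (shift G) x" using shift_one[OF x] by (simp add: stabilizer_def)
next
  fix g h
  assume "g \<in> stabilizer G (shift G) x" "h \<in> stabilizer G (shift G) x"
  then show "g \<otimes> h \<in> stabilizer G (shift G) x" by (simp add: stabilizer_def shift_mult)
next
  fix g
  assume "g \<in> stabilizer G (shift G) x"
  then have g: "g \<in> carrier G" and fix_g: "shift G g x = x" by (auto simp: stabilizer_def)
  have "shift G (inv g) x = shift G (inv g \<otimes> g) x" using g by (simp only: shift_mult inv_closed fix_g)
  also have "\<dots> = x" using g shift_one[OF x] by simp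
  finally show "inv g \<in> stabilizer G (shift G) x" using g by (simp add: stabilizer_def)
qed

lemma constant_if_stabilizer_carrier:
  assumes "stabilizer G (shift G) x = carrier G" and h: "h \<in> carrier G"
  shows "x h = x \<one>"
proof -
  have "inv h \<in> stabilizer G (shift G) x" using assms by simp
  then have "shift G (inv h) x \<one> = x \<one>" by (simp add: stabilizer_def)
  then show ?thesis using h by (simp add: shift_def)
qed

end

text \<open>Since \<open>shift G g x\<close> takes on \<open>D\<close> the values of \<open>x\<close> on \<open>inv g <# D\<close>, forbidding these patterns
  for a subgroup \<open>D\<close> says that no left coset of \<open>D\<close> is monochromatic.\<close>

definition monochromatic_patterns :: "'g set \<Rightarrow> 'a set \<Rightarrow> ('g set \<times> ('g \<Rightarrow> 'a)) set" where
  "monochromatic_patterns D A = (\<lambda>a. (D, \<lambda>_ \<in> D. a)) ` A"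

definition nonmonochromatic_shift ::
  "('g, 'm) monoid_scheme \<Rightarrow> 'g set \<Rightarrow> 'a set \<Rightarrow> ('g \<Rightarrow> 'a) set" where
  "nonmonochromatic_shift G D A = {x \<in> carrier G \<rightarrow>\<^sub>E A.
     \<forall>g \<in> carrier G. \<forall>(E, w) \<in> monochromatic_patterns D A. restrict (shift G g x) E \<noteq> w}"

lemma subshift_of_finite_type_nonmonochromatic_shift:
  assumes "finite A" "finite D" "D \<subseteq> carrier G"
  shows "subshift_of_finite_type G A (nonmonochromatic_shift G D A)"
  unfolding subshift_of_finite_type_def
proof (intro exI conjI)
  show "finite (monochromatic_patterns D A)"
    using assms(1) by (simp add: monochromatic_patterns_def)
  show "\<forall>(E, w) \<in> monochromatic_patterns D A. finite E \<and> E \<subseteq> carrier G \<and> w \<in> E \<rightarrow>\<^sub>E A"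
    using assms(2,3) by (auto simp: monochromatic_patterns_def)
qed (rule nonmonochromatic_shift_def)

context group
begin

text \<open>The witness marks one chosen point in each left coset. A coset then contains a 1, and also
  a 0 because \<open>D\<close> has a second element.\<close>

lemma ex_nonmonochromatic_configuration:
  assumes D: "subgroup D G" and s: "s \<in> D" "s \<noteq> \<one>"
  shows "nonmonochromatic_shift G D {0, 1::nat} \<noteq> {}"
proof -
  define rep where "rep h = (SOME y. y \<in> h <# D)" for h
  define x :: "'a \<Rightarrow> nat" where "x = (\<lambda>h \<in> carrier G. of_bool (h = rep h))"
  have "restrict (shift G g x) D \<noteq> (\<lambda>_ \<in> D. a)" if g: "g \<in> carrier G" for g a
  proof
    assume eq: "restrict (shift G g x) D = (\<lambda>_ \<in> D. a)"
    let ?k = "inv g"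
    have k: "?k \<in> carrier G" using g by simp
    have sc: "s \<in> carrier G" using subgroup.mem_carrier[OF D s(1)] .
    have mono: "x y = a" if "y \<in> ?k <# D" for y
    proof -
      obtain d where d: "d \<in> D" "y = ?k \<otimes> d" using \<open>y \<in> ?k <# D\<close> by (auto simp: l_coset_def)
      have "shift G g x d = a" using fun_cong[OF eq, of d] d(1) by simp
      then show ?thesis using d subgroup.mem_carrier[OF D d(1)] by (simp add: shift_def)
    qed
    have in_carrier: "y \<in> carrier G" if "y \<in> ?k <# D" for y
      using l_coset_subset_G[OF subgroup.subset[OF D] k] that by blast
    have rep_eq: "rep y = rep ?k" if "y \<in> ?k <# D" for y
      using l_repr_independence[OF that k D] by (simp add: rep_def)
    have k_in: "?k \<in> ?k <# D"
      using k subgroup.one_closed[OF D] by (force simp: l_coset_def)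
    have ks_in: "?k \<otimes> s \<in> ?k <# D" using s(1) by (auto simp: l_coset_def)
    have rep_in: "rep ?k \<in> ?k <# D" unfolding rep_def using k_in by (rule someI)
    have "a = 1"
      using mono[OF rep_in] in_carrier[OF rep_in] rep_eq[OF rep_in] by (simp add: x_def)
    \<comment> \<open>Colour 1 throughout would make every point of the coset its chosen representative.\<close>
    have "y = rep ?k" if y: "y \<in> ?k <# D" for y
    proof -
      have "x y = 1" using mono[OF y] \<open>a = 1\<close> by simp
      moreover have "x y = of_bool (y = rep y)"
        unfolding x_def using in_carrier[OF y] by (rule restrict_apply')
      ultimately have "y = rep y" by (simp only: of_bool_eq_1_iff)
      then show ?thesis using rep_eq[OF y] by (rule trans)
    qed
    then have "?k \<otimes> s = ?k" using k_in ks_in by metis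
    then show False using s(2) k sc by simp
  qed
  moreover have "x \<in> carrier G \<rightarrow>\<^sub>E {0, 1}" by (auto simp: x_def)
  ultimately have "x \<in> nonmonochromatic_shift G D {0, 1}"
    by (auto simp: nonmonochromatic_shift_def monochromatic_patterns_def)
  then show ?thesis by blast
qed

lemma nonmonochromatic_not_fixed:
  assumes D: "D \<subseteq> carrier G" and x: "x \<in> nonmonochromatic_shift G D A"
  shows "stabilizer G (shift G) x \<noteq> carrier G"
proof
  assume fixed: "stabilizer G (shift G) x = carrier G"
  have xA: "x \<in> carrier G \<rightarrow>\<^sub>E A" using x by (simp add: nonmonochromatic_shift_def)
  have "shift G \<one> x = x" using xA by (intro shift_one) (simp add: PiE_def)
  moreover have "x d = x \<one>" if "d \<in> D" for d
    using constant_if_stabilizer_carrier[OF fixed] that D by blast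
  ultimately have "restrict (shift G \<one> x) D = (\<lambda>_ \<in> D. x \<one>)"
    by (intro restrict_ext) metis
  moreover have "x \<one> \<in> A" using xA by auto
  ultimately show False
    using x by (auto simp: nonmonochromatic_shift_def monochromatic_patterns_def)
qed

end

lemma (in tarski_monster) ex_finite_nontrivial_subgroup:
  obtains D s where "subgroup D G" "finite D" "s \<in> D" "s \<noteq> \<one>"
proof -
  have "carrier G \<noteq> {\<one>}" using infinite_carrier by auto
  then obtain s where s: "s \<in> carrier G" "s \<noteq> \<one>" using one_closed by blast
  show thesis
  proof
    show "subgroup (generate G {s}) G" using s(1) by (simp add: generate_is_subgroup)
    have "card (generate G {s}) \<noteq> 0" using generate_pow_card[OF s(1)] ord_nonzero[OF s(1)] by simp
    then show "finite (generate G {s})" by (meson card.infinite)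
    show "s \<in> generate G {s}" by (simp add: generate.incl)
  qed (rule s(2))
qed

theorem proposition4p2:
  fixes G :: "('g, 'm) monoid_scheme"
  assumes "tarski_monster G"
  shows "admits_strongly_aperiodic_SFT G"
proof -
  interpret tarski_monster G by (rule assms)
  obtain D s where D: "subgroup D G" "finite D" and s: "s \<in> D" "s \<noteq> \<one>\<^bsub>G\<^esub>"
    by (rule ex_finite_nontrivial_subgroup)
  let ?S = "nonmonochromatic_shift G D {0, 1::nat}"
  have sub: "D \<subseteq> carrier G" using D(1) by (rule subgroup.subset)
  have "finite (stabilizer G (shift G) x)" if x: "x \<in> ?S" for x
  proof (rule ccontr)
    assume inf: "infinite (stabilizer G (shift G) x)"
    have "x \<in> extensional (carrier G)"
      using x by (simp add: nonmonochromatic_shift_def PiE_def)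
    then have "stabilizer G (shift G) x = carrier G"
      using infinite_subgroup[OF subgroup_stabilizer_shift inf] by blast
    then show False using nonmonochromatic_not_fixed[OF sub x] by blast
  qed
  then have "strongly_aperiodic G ?S"
    using ex_nonmonochromatic_configuration[OF D(1) s] by (simp add: strongly_aperiodic_def)
  moreover have "subshift_of_finite_type G {0, 1::nat} ?S"
    using D(2) sub by (intro subshift_of_finite_type_nonmonochromatic_shift) simp_all
  ultimately show ?thesis
    unfolding admits_strongly_aperiodic_SFT_def by (meson finite.emptyI finite.insertI)
qed

end
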